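(* Let $A$ be the generator of a symmetric Markov semigroup $(e^{-tA})_{t\ge0}$ on $L^2(X,d\mu)$, where $(X,d\mu)$ is a $\sigma$-finite measure space, and let $\beta:(0,+\infty)\to\mathbb{R}$ be a function. Assume that, for all nonzero $f\in\mathcal{D}(A)$, $$\int f^2\log_+\!\left(|f|/\|f\|_2\right)d\mu\le t\,(Af,f)+\beta(t)\|f\|_2^2,\qquad\forall t>0 .$$ Set $$\Lambda(y)=\sup_{t>0}\left(ty/2-N(t)\right),\ y\in\mathbb{R},\qquad\text{with } N(t)=t\,\beta(1/t).$$ Then, for all nonzero $f\in\mathcal{D}(A)$ with $\|f\|_1\le 1$, $$\|f\|_2^2\,\Lambda\!\left(\ln\|f\|_2^2\right)\le (Af,f).$$
   Context: $A$ is nonnegative self-adjoint, with domain $\mathcal{D}(A)$ in $L^2$; functions are real-valued. $\log_+x=\max(\log x,0)$ (with $\log_+0=0$). *)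

theory Defs
  imports "HOL-Analysis.Analysis"
begin

text \<open>
  Elements of \<open>L\<^sup>2(X, \<mu>)\<close> are represented by real-valued functions, identified up to equality almost
  everywhere. Operators act on representatives; \<open>L2_operator\<close> requires the domain and the
  operator to be compatible with this identification.
\<close>

definition L2_space :: "'a measure \<Rightarrow> ('a \<Rightarrow> real) set" where
  "L2_space M = {f \<in> borel_measurable M. integrable M (\<lambda>x. (f x)\<^sup>2)}"

definition L2_inner :: "'a measure \<Rightarrow> ('a \<Rightarrow> real) \<Rightarrow> ('a \<Rightarrow> real) \<Rightarrow> real" where
  "L2_inner M f g = (\<integral>x. f x * g x \<partial>M)"

definition L2_norm :: "'a measure \<Rightarrow> ('a \<Rightarrow> real) \<Rightarrow> real" where
  "L2_norm M f = sqrt (\<integral>x. (f x)\<^sup>2 \<partial>M)"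

definition L1_norm :: "'a measure \<Rightarrow> ('a \<Rightarrow> real) \<Rightarrow> ennreal" where
  "L1_norm M f = (\<integral>\<^sup>+x. ennreal \<bar>f x\<bar> \<partial>M)"

definition L2_operator ::
    "'a measure \<Rightarrow> ('a \<Rightarrow> real) set \<Rightarrow> (('a \<Rightarrow> real) \<Rightarrow> 'a \<Rightarrow> real) \<Rightarrow> bool" where
  "L2_operator M D A \<longleftrightarrow>
     D \<subseteq> L2_space M \<and> (\<lambda>x. 0) \<in> D \<and>
     (\<forall>f\<in>D. \<forall>g\<in>D. \<forall>a b. (\<lambda>x. a * f x + b * g x) \<in> D) \<and>
     (\<forall>f\<in>D. \<forall>g\<in>L2_space M. (AE x in M. f x = g x) \<longrightarrow> g \<in> D) \<and>
     (\<forall>f\<in>D. A f \<in> L2_space M) \<and>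
     (\<forall>f\<in>D. \<forall>g\<in>D. (AE x in M. f x = g x) \<longrightarrow> (AE x in M. A f x = A g x)) \<and>
     (\<forall>f\<in>D. \<forall>g\<in>D. \<forall>a b. AE x in M. A (\<lambda>x. a * f x + b * g x) x = a * A f x + b * A g x)"

text \<open>
  The last conjunct says that the adjoint of \<open>A\<close> is contained in \<open>A\<close>; the reverse inclusion is symmetry.
\<close>

definition nonneg_self_adjoint ::
    "'a measure \<Rightarrow> ('a \<Rightarrow> real) set \<Rightarrow> (('a \<Rightarrow> real) \<Rightarrow> 'a \<Rightarrow> real) \<Rightarrow> bool" where
  "nonneg_self_adjoint M D A \<longleftrightarrow>
     L2_operator M D A \<and>
     (\<forall>f\<in>L2_space M. \<forall>\<epsilon>>0. \<exists>g\<in>D. L2_norm M (\<lambda>x. f x - g x) < \<epsilon>) \<and>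
     (\<forall>f\<in>D. 0 \<le> L2_inner M (A f) f) \<and>
     (\<forall>f\<in>D. \<forall>g\<in>D. L2_inner M (A f) g = L2_inner M f (A g)) \<and>
     (\<forall>g\<in>L2_space M. \<forall>h\<in>L2_space M.
        (\<forall>f\<in>D. L2_inner M (A f) g = L2_inner M f h) \<longrightarrow> g \<in> D \<and> (AE x in M. A g x = h x))"

text \<open>
  Strongly continuous symmetric contraction semigroup on \<open>L\<^sup>2\<close> that is positivity preserving and
  contractive on \<open>L\<^sup>\<infinity>\<close>; the last two properties together are the implication
  from \<open>0 \<le> f \<le> 1\<close> to \<open>0 \<le> T\<^sub>t f \<le> 1\<close>. Conservativeness (\<open>T\<^sub>t 1 = 1\<close>) is not demanded.
\<close>

definition symmetric_Markov_semigroup ::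
    "'a measure \<Rightarrow> (real \<Rightarrow> ('a \<Rightarrow> real) \<Rightarrow> 'a \<Rightarrow> real) \<Rightarrow> bool" where
  "symmetric_Markov_semigroup M T \<longleftrightarrow>
     (\<forall>t\<ge>0. L2_operator M (L2_space M) (T t)) \<and>
     (\<forall>f\<in>L2_space M. AE x in M. T 0 f x = f x) \<and>
     (\<forall>s\<ge>0. \<forall>t\<ge>0. \<forall>f\<in>L2_space M. AE x in M. T (s + t) f x = T s (T t f) x) \<and>
     (\<forall>f\<in>L2_space M. ((\<lambda>t. L2_norm M (\<lambda>x. T t f x - f x)) \<longlongrightarrow> 0) (at_right 0)) \<and>
     (\<forall>t\<ge>0. \<forall>f\<in>L2_space M. L2_norm M (T t f) \<le> L2_norm M f) \<and>
     (\<forall>t\<ge>0. \<forall>f\<in>L2_space M. \<forall>g\<in>L2_space M. L2_inner M (T t f) g = L2_inner M f (T t g)) \<and>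
     (\<forall>t\<ge>0. \<forall>f\<in>L2_space M.
        (AE x in M. 0 \<le> f x \<and> f x \<le> 1) \<longrightarrow> (AE x in M. 0 \<le> T t f x \<and> T t f x \<le> 1))"

text \<open>
  Sign convention: \<open>T\<^sub>t = e\<^sup>-\<^sup>t\<^sup>A\<close>, so \<open>A f\<close> is the \<open>L\<^sup>2\<close>-limit of \<open>(f - T\<^sub>t f) / t\<close>, and the domain \<open>D\<close>
  of \<open>A\<close> consists of all \<open>f\<close> for which that limit exists.
\<close>

definition generates ::
    "'a measure \<Rightarrow> ('a \<Rightarrow> real) set \<Rightarrow> (('a \<Rightarrow> real) \<Rightarrow> 'a \<Rightarrow> real) \<Rightarrow>
     (real \<Rightarrow> ('a \<Rightarrow> real) \<Rightarrow> 'a \<Rightarrow> real) \<Rightarrow> bool" where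
  "generates M D A T \<longleftrightarrow>
     D = {f \<in> L2_space M. \<exists>g\<in>L2_space M.
            ((\<lambda>t. L2_norm M (\<lambda>x. (f x - T t f x) / t - g x)) \<longlongrightarrow> 0) (at_right 0)} \<and>
     (\<forall>f\<in>D. A f \<in> L2_space M \<and>
        ((\<lambda>t. L2_norm M (\<lambda>x. (f x - T t f x) / t - A f x)) \<longlongrightarrow> 0) (at_right 0))"

definition log_plus :: "real \<Rightarrow> real" where
  "log_plus x = (if x > 0 then max (ln x) 0 else 0)"

definition N_fun :: "(real \<Rightarrow> real) \<Rightarrow> real \<Rightarrow> real" where
  "N_fun \<beta> t = t * \<beta> (1 / t)"

text \<open>The supremum may be \<open>+\<infinity>\<close>, hence the extended real values.\<close>

definition Lambda_fun :: "(real \<Rightarrow> real) \<Rightarrow> real \<Rightarrow> ereal" where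
  "Lambda_fun \<beta> y = (SUP t\<in>{0<..}. ereal (t * y / 2 - N_fun \<beta> t))"

text \<open>
  The integral of the logarithmic Sobolev inequality is taken in \<open>[0, \<infinity>]\<close>, so the inequality includes
  its finiteness. The comparison is made in \<open>ereal\<close>, because the right-hand side
  may be negative and \<open>ennreal\<close> would truncate it to 0.
\<close>

definition log_Sobolev_family ::
    "'a measure \<Rightarrow> ('a \<Rightarrow> real) set \<Rightarrow> (('a \<Rightarrow> real) \<Rightarrow> 'a \<Rightarrow> real) \<Rightarrow> (real \<Rightarrow> real) \<Rightarrow> bool" where
  "log_Sobolev_family M D A \<beta> \<longleftrightarrow>
     (\<forall>f\<in>D. \<not> (AE x in M. f x = 0) \<longrightarrow>
        (\<forall>t>0. enn2ereal (\<integral>\<^sup>+x. ennreal ((f x)\<^sup>2 * log_plus (\<bar>f x\<bar> / L2_norm M f)) \<partial>M)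
                \<le> ereal (t * L2_inner M (A f) f + \<beta> t * (L2_norm M f)\<^sup>2)))"

end

theory Submission
  imports Defs
begin

text \<open>
  The tangent line of the logarithm bounds \<open>f\<^sup>2 log\<^sub>+ (|f| / n)\<close>, where \<open>n\<close> is the \<open>L\<^sup>2\<close> norm of \<open>f\<close>,
  from below by \<open>f\<^sup>2 (ln n + 1) - n\<^sup>2 |f|\<close>; this is Jensen's inequality for the probability measure
  with density \<open>f\<^sup>2 / n\<^sup>2\<close> in pointwise form. Integrating and using that the \<open>L\<^sup>1\<close> norm is at most 1,
  the left-hand side of the logarithmic Sobolev inequality is at least \<open>n\<^sup>2 ln n\<close>. The parameter \<open>1 / t\<close>
  in that inequality then bounds each term of the supremum.
\<close>

lemma square_log_plus_ge:
  assumes "n > 0"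
  shows "x\<^sup>2 * (ln n + 1) - n\<^sup>2 * \<bar>x\<bar> \<le> x\<^sup>2 * log_plus (\<bar>x\<bar> / n)"
proof (cases "x = 0")
  case False
  then have x: "\<bar>x\<bar> > 0" by simp
  \<comment> \<open>Applying \<open>ln u \<le> u - 1\<close> at
    \<open>u = n\<^sup>2 / \<bar>x\<bar>\<close> leaves, after multiplication by
    \<open>x\<^sup>2\<close>, an error linear in \<open>\<bar>x\<bar>\<close>, which the
    \<open>L\<^sup>1\<close> norm controls.\<close>
  have "ln (n\<^sup>2 / \<bar>x\<bar>) \<le> n\<^sup>2 / \<bar>x\<bar> - 1"
    using assms x by (intro ln_le_minus_one) simp
  then have "ln n + 1 - n\<^sup>2 / \<bar>x\<bar> \<le> ln (\<bar>x\<bar> / n)"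
    using assms x by (simp add: ln_div ln_realpow)
  also have "\<dots> \<le> log_plus (\<bar>x\<bar> / n)"
    using assms x by (simp add: log_plus_def)
  finally have "x\<^sup>2 * (ln n + 1 - n\<^sup>2 / \<bar>x\<bar>) \<le> x\<^sup>2 * log_plus (\<bar>x\<bar> / n)"
    by (rule mult_left_mono) simp
  moreover have "x\<^sup>2 * (n\<^sup>2 / \<bar>x\<bar>) = n\<^sup>2 * \<bar>x\<bar>"
    using x by (simp add: field_simps power2_eq_square)
  ultimately show ?thesis
    by (simp add: right_diff_distrib)
qed simp

lemma log_plus_nonneg: "0 \<le> log_plus x"
  by (simp add: log_plus_def)

lemma log_plus_measurable [measurable]: "log_plus \<in> borel_measurable borel"
  unfolding log_plus_def by measurable

lemma L2_norm_pos:
  assumes "f \<in> L2_space M" and "\<not> (AE x in M. f x = 0)"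
  shows "L2_norm M f > 0"
proof -
  have "(\<integral>x. (f x)\<^sup>2 \<partial>M) \<noteq> 0"
    using assms integral_nonneg_eq_0_iff_AE[of M "\<lambda>x. (f x)\<^sup>2"]
    by (simp add: L2_space_def)
  then show ?thesis
    by (simp add: L2_norm_def less_le)
qed

lemma square_norm_mult_ln_le_entropy:
  assumes f: "f \<in> L2_space M" "\<not> (AE x in M. f x = 0)" and L1: "L1_norm M f \<le> 1"
  shows "ereal ((L2_norm M f)\<^sup>2 * ln (L2_norm M f))
           \<le> enn2ereal (\<integral>\<^sup>+x. ennreal ((f x)\<^sup>2 * log_plus (\<bar>f x\<bar> / L2_norm M f)) \<partial>M)"
    (is "_ \<le> enn2ereal (\<integral>\<^sup>+x. ennreal (?g x) \<partial>M)")
proof (cases "(\<integral>\<^sup>+x. ennreal (?g x) \<partial>M) = \<infinity>")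
  \<comment> \<open>An infinite integral makes the bound trivial. Finiteness makes \<open>?g\<close>
    integrable, so the rest can use real-valued integrals.\<close>
  case False
  define n where "n = L2_norm M f"
  have n: "n > 0"
    unfolding n_def using f by (rule L2_norm_pos)
  have [measurable]: "f \<in> borel_measurable M" and sq: "integrable M (\<lambda>x. (f x)\<^sup>2)"
    using f by (auto simp: L2_space_def)
  have n2: "(\<integral>x. (f x)\<^sup>2 \<partial>M) = n\<^sup>2"
    by (simp add: n_def L2_norm_def)
  have g0: "0 \<le> ?g x" for x
    by (simp add: log_plus_nonneg)
  have g: "integrable M ?g"
    using False g0 by (intro integrableI_nonneg) (auto simp: top.not_eq_extremum)
  have abs: "integrable M (\<lambda>x. \<bar>f x\<bar>)"
    using L1 by (intro integrableI_nonneg) (auto simp: L1_norm_def intro: le_less_trans)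
  have "ennreal (\<integral>x. \<bar>f x\<bar> \<partial>M) \<le> 1"
    using L1 abs by (simp add: nn_integral_eq_integral L1_norm_def)
  then have "n\<^sup>2 * (\<integral>x. \<bar>f x\<bar> \<partial>M) \<le> n\<^sup>2"
    by (simp add: mult_left_le)
  \<comment> \<open>The \<open>+ 1\<close> from the tangent line absorbs the
    \<open>L\<^sup>1\<close> term, since both carry the weight \<open>n\<^sup>2\<close>.\<close>
  then have "n\<^sup>2 * ln n \<le> n\<^sup>2 * (ln n + 1) - n\<^sup>2 * (\<integral>x. \<bar>f x\<bar> \<partial>M)"
    by (simp add: distrib_left)
  also have "\<dots> = (\<integral>x. (f x)\<^sup>2 * (ln n + 1) - n\<^sup>2 * \<bar>f x\<bar> \<partial>M)"
    using sq abs by (simp add: n2)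
  also have "\<dots> \<le> (\<integral>x. ?g x \<partial>M)"
    using sq abs g square_log_plus_ge[OF n] by (intro integral_mono) (auto simp: n_def)
  finally show ?thesis
    using g g0 by (simp add: nn_integral_eq_integral n_def enn2ereal_ennreal)
qed simp

theorem theorem5p2:
  fixes M :: "'a measure"
    and T :: "real \<Rightarrow> ('a \<Rightarrow> real) \<Rightarrow> 'a \<Rightarrow> real"
    and D :: "('a \<Rightarrow> real) set"
    and A :: "('a \<Rightarrow> real) \<Rightarrow> 'a \<Rightarrow> real"
    and \<beta> :: "real \<Rightarrow> real"
  assumes "sigma_finite_measure M"
    and "symmetric_Markov_semigroup M T"
    and "generates M D A T"
    and "nonneg_self_adjoint M D A"
    and "log_Sobolev_family M D A \<beta>"
  shows "\<forall>f\<in>D. \<not> (AE x in M. f x = 0) \<longrightarrow> L1_norm M f \<le> 1 \<longrightarrow>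
           ereal ((L2_norm M f)\<^sup>2) * Lambda_fun \<beta> (ln ((L2_norm M f)\<^sup>2))
             \<le> ereal (L2_inner M (A f) f)"
proof (intro ballI impI)
  fix f
  assume fD: "f \<in> D" and f0: "\<not> (AE x in M. f x = 0)" and L1: "L1_norm M f \<le> 1"
  define n where "n = L2_norm M f"
  define E where "E = L2_inner M (A f) f"
  have f: "f \<in> L2_space M"
    using assms(4) fD by (auto simp: nonneg_self_adjoint_def L2_operator_def)
  have n: "n > 0"
    unfolding n_def using f f0 by (rule L2_norm_pos)
  have "t * ln (n\<^sup>2) / 2 - N_fun \<beta> t \<le> E / n\<^sup>2" if t: "t > 0" for t
  proof -
    have "1 / t > 0"
      using t by simp
    with assms(5) fD f0 have "ereal (n\<^sup>2 * ln n) \<le> ereal (1 / t * E + \<beta> (1 / t) * n\<^sup>2)"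
      unfolding n_def E_def log_Sobolev_family_def
      by (blast intro: order_trans square_norm_mult_ln_le_entropy[OF f f0 L1])
    then have "n\<^sup>2 * ln n \<le> E / t + \<beta> (1 / t) * n\<^sup>2"
      by simp
    \<comment> \<open>Multiplying by \<open>t / n\<^sup>2\<close> turns
      \<open>\<beta> (1 / t)\<close> into \<open>N_fun \<beta> t\<close>; the factor 1/2 cancels the
      2 in \<open>ln (n\<^sup>2) = 2 * ln n\<close>.\<close>
    then show ?thesis
      using n t by (simp add: N_fun_def ln_realpow field_simps)
  qed
  \<comment> \<open>The bound is real and independent of \<open>t\<close>, so the supremum cannot be
    infinite here.\<close>
  then have "Lambda_fun \<beta> (ln (n\<^sup>2)) \<le> ereal (E / n\<^sup>2)"
    unfolding Lambda_fun_def by (intro SUP_least) simp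
  then have "ereal (n\<^sup>2) * Lambda_fun \<beta> (ln (n\<^sup>2)) \<le> ereal (n\<^sup>2) * ereal (E / n\<^sup>2)"
    by (rule ereal_mult_left_mono) simp
  also have "\<dots> = ereal E"
    using n by simp
  finally show "ereal ((L2_norm M f)\<^sup>2) * Lambda_fun \<beta> (ln ((L2_norm M f)\<^sup>2))
      \<le> ereal (L2_inner M (A f) f)"
    by (simp add: n_def E_def)
qed

end
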